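(* Let $G^\sigma$ be a signed graph whose underlying graph $G$ is connected and bipartite, and whose adjacency matrix has all but at most two eigenvalues (counted with multiplicity) equal to $\pm1$. Then $G^\sigma$ is switching isomorphic with an unsigned (all edges positive) connected bipartite graph whose adjacency matrix also has all but at most two eigenvalues equal to $\pm 1$.
   Context: A signed graph $G^\sigma$ is a finite simple graph $G$ with a signature $\sigma:E(G)\to\{-1,+1\}$; its adjacency matrix has entry $\sigma(\{u,v\})$ for edges and $0$ otherwise. Switching with respect to a vertex subset $X$ changes the sign of every edge between $X$ and $V\setminus X$; two signed graphs are switching isomorphic if one can be switched into an isomorphic copy of the other. *)

theory Defs
  imports
    "Graph_Theory.Pair_Digraph"
    "Graph_Theory.Digraph_Component"
    "Jordan_Normal_Form.Char_Poly"
    "HOL-Computational_Algebra.Fundamental_Theorem_Algebra"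
begin

(* Finite simple graphs are the instances of pair_graph: an edge {u, v} is represented by
   the two arcs (u, v) and (v, u). A signature is a function on two-element vertex sets;
   its values on sets that are not edges are irrelevant everywhere below. *)

definition signed_graph :: "'a pair_pre_digraph \<Rightarrow> ('a set \<Rightarrow> int) \<Rightarrow> bool" where
  "signed_graph G \<sigma> \<longleftrightarrow> pair_graph G \<and> (\<forall>(u, v) \<in> parcs G. \<sigma> {u, v} \<in> {-1, 1})"

definition connected_graph :: "'a pair_pre_digraph \<Rightarrow> bool" where
  "connected_graph G \<longleftrightarrow> Digraph_Component.connected (with_proj G)"

definition bipartite_graph :: "'a pair_pre_digraph \<Rightarrow> bool" where
  "bipartite_graph G \<longleftrightarrow>
     (\<exists>X Y. pverts G = X \<union> Y \<and> X \<inter> Y = {} \<and> parcs G \<subseteq> X \<times> Y \<union> Y \<times> X)"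

definition all_positive :: "'a set \<Rightarrow> int" where
  "all_positive = (\<lambda>_. 1)"

definition switch :: "'a set \<Rightarrow> ('a set \<Rightarrow> int) \<Rightarrow> 'a set \<Rightarrow> int" where
  "switch X \<sigma> e = (if e \<inter> X \<noteq> {} \<and> \<not> e \<subseteq> X then - \<sigma> e else \<sigma> e)"

definition signed_graph_iso ::
    "'a pair_pre_digraph \<Rightarrow> ('a set \<Rightarrow> int) \<Rightarrow> 'b pair_pre_digraph \<Rightarrow> ('b set \<Rightarrow> int) \<Rightarrow> bool" where
  "signed_graph_iso G \<sigma> H \<tau> \<longleftrightarrow>
     (\<exists>f. bij_betw f (pverts G) (pverts H) \<and>
          (\<forall>u \<in> pverts G. \<forall>v \<in> pverts G. (u, v) \<in> parcs G \<longleftrightarrow> (f u, f v) \<in> parcs H) \<and>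
          (\<forall>(u, v) \<in> parcs G. \<tau> {f u, f v} = \<sigma> {u, v}))"

definition switching_isomorphic ::
    "'a pair_pre_digraph \<Rightarrow> ('a set \<Rightarrow> int) \<Rightarrow> 'b pair_pre_digraph \<Rightarrow> ('b set \<Rightarrow> int) \<Rightarrow> bool" where
  "switching_isomorphic G \<sigma> H \<tau> \<longleftrightarrow>
     (\<exists>X. X \<subseteq> pverts G \<and> signed_graph_iso G (switch X \<sigma>) H \<tau>)"

(* Matrices here are indexed by natural numbers, so the vertices are listed in some fixed
   order; another order only conjugates the adjacency matrix by a permutation matrix. *)
definition vertex_order :: "'a pair_pre_digraph \<Rightarrow> 'a list" where
  "vertex_order G = (SOME vs. distinct vs \<and> set vs = pverts G)"

definition adjacency_matrix :: "'a pair_pre_digraph \<Rightarrow> ('a set \<Rightarrow> int) \<Rightarrow> real mat" where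
  "adjacency_matrix G \<sigma> =
     (let vs = vertex_order G in
      mat (length vs) (length vs)
        (\<lambda>(i, j). if (vs ! i, vs ! j) \<in> parcs G then real_of_int (\<sigma> {vs ! i, vs ! j}) else 0))"

(* Complex roots of the characteristic polynomial, so that the multiset has as many elements
   as the matrix has rows. *)
definition eigenvalues_mset :: "real mat \<Rightarrow> complex multiset" where
  "eigenvalues_mset A = proots (char_poly (map_mat complex_of_real A))"

lemma vertex_order:
  assumes "pair_graph G"
  shows "distinct (vertex_order G)" "set (vertex_order G) = pverts G"
proof -
  interpret pair_graph G by fact
  have "\<exists>vs. distinct vs \<and> set vs = pverts G"
    using finite_distinct_list[OF pair_finite_verts] by blast
  from someI_ex[OF this] show "distinct (vertex_order G)" "set (vertex_order G) = pverts G"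
    by (simp_all add: vertex_order_def)
qed

lemma size_eigenvalues_mset:
  assumes "A \<in> carrier_mat n n"
  shows "size (eigenvalues_mset A) = n"
  using assms degree_monic_char_poly[of "map_mat complex_of_real A" n]
  by (simp add: eigenvalues_mset_def size_proots_complex)

end

theory Submission
  imports
    Defs
    "Jordan_Normal_Form.Jordan_Normal_Form_Existence"
    "Jordan_Normal_Form.Jordan_Normal_Form_Uniqueness"
begin

text \<open>
  Let A be the signed adjacency matrix and N its bipartite block, with parts X and Y. Since A is
  symmetric, its eigenvalues 1 and -1 are semisimple, so A A - I has rank at most two. This matrix is
  block diagonal with blocks N N^T - I and N^T N - I; hence one block vanishes or the other has rank
  at most one, and in either case some part has a block all of whose 2x2 minors vanish. For that part,
  say X, the inner product of the rows x and y is, up to sign, the geometric mean of deg x - 1 and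
  deg y - 1. If deg x is the smaller degree, the inner product is at least deg x - 1 in absolute
  value, while there are at most deg x common neighbours; a single disagreement of signs would cost 2.
  So any two rows agree up to a global sign on their common support. The rank one structure makes
  these global signs consistent, so that the graph is balanced and can be switched to all positive
  signs, which conjugates A by a diagonal sign matrix.
\<close>

section \<open>Sign patterns forced by a Gram matrix that is the identity plus rank one\<close>

text \<open>The proof splits on whether some row has two nonzero entries in \<open>W\<close>:
  exactly then \<open>g\<close> has a positive diagonal value, and that row can serve as a reference
  for all signs. Agreement is phrased by nonnegative products, so that entries off the common
  support, where the product is 0, need no separate treatment.\<close>

lemma gram_rank_one_signs:
  fixes N :: "'a \<Rightarrow> 'b \<Rightarrow> int" and W :: "'b set"
  defines "g \<equiv> \<lambda>x y. (\<Sum>w\<in>W. N x w * N y w) - (if x = y then 1 else 0)"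
  assumes W: "finite W"
    and N: "\<And>x w. \<bar>N x w\<bar> \<le> 1"
    and minors: "\<And>i j k l. i \<in> X \<Longrightarrow> j \<in> X \<Longrightarrow> k \<in> X \<Longrightarrow> l \<in> X \<Longrightarrow> g i j * g k l = g i l * g k j"
  shows "\<exists>p. (\<forall>x. p x \<in> {-1, 1}) \<and>
             (\<forall>x\<in>X. \<forall>y\<in>X. \<forall>w\<in>W. p x * N x w * (p y * N y w) \<ge> 0)"
proof -
  have NN: "N x w \<in> {-1, 0, 1}" for x w
    using N[of x w] by auto
  have deg: "g x x = (\<Sum>w\<in>W. \<bar>N x w\<bar>) - 1" for x
  proof -
    have "N x w * N x w = \<bar>N x w\<bar>" for w using NN[of x w] by auto
    then show ?thesis by (simp add: g_def)
  qed
  have sym: "g x y = g y x" for x y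
    by (simp add: g_def mult.commute)
  show ?thesis
  proof (cases "\<exists>i\<in>X. g i i > 0")
    case False
    \<comment> \<open>Since \<open>g x x\<close> is the number of nonzero entries minus 1, a
      nonpositive value leaves at most one such entry, and \<open>p x\<close> can be its
      sign.\<close>
    have unique: "v = w" if x: "x \<in> X" and vw: "v \<in> W" "w \<in> W" "N x v \<noteq> 0" "N x w \<noteq> 0" for x v w
    proof (rule ccontr)
      assume "v \<noteq> w"
      then have "(\<Sum>u\<in>{v, w}. \<bar>N x u\<bar>) \<ge> 2"
        using vw NN[of x v] NN[of x w] by auto
      moreover have "(\<Sum>u\<in>{v, w}. \<bar>N x u\<bar>) \<le> (\<Sum>u\<in>W. \<bar>N x u\<bar>)"
        using vw W by (intro sum_mono2) auto
      ultimately show False using False x deg[of x] by force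
    qed
    define p :: "'a \<Rightarrow> int" where "p x = (if \<exists>w\<in>W. N x w = -1 then -1 else 1)" for x
    have "p x * N x w \<ge> 0" if "x \<in> X" "w \<in> W" for x w
    proof -
      consider "N x w = -1" | "N x w = 0" | "N x w = 1" using NN[of x w] by auto
      then show ?thesis
      proof cases
        case 3
        then have "\<not> (\<exists>v\<in>W. N x v = -1)" using unique[OF that(1) _ that(2)] by force
        with 3 show ?thesis by (simp add: p_def)
      qed (use that in \<open>auto simp: p_def\<close>)
    qed
    then show ?thesis by (intro exI[of _ p]) (auto simp: p_def)
  next
    case True
    then obtain i where i: "i \<in> X" "g i i > 0" by auto
    \<comment> \<open>Row \<open>i\<close> is the reference:
      \<open>g i i * g x y = g i x * g i y\<close> with \<open>g i i > 0\<close> makes the sign of a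
      nonzero \<open>g x y\<close> the product of the signs of \<open>g i x\<close> and
      \<open>g i y\<close>. If \<open>g i x = 0\<close>, either sign would do.\<close>
    define p :: "'a \<Rightarrow> int" where "p x = (if g i x < 0 then -1 else 1)" for x
    have p: "p x \<in> {-1, 1}" for x by (simp add: p_def)
    \<comment> \<open>A zero row would have \<open>g x x = -1\<close>. Excluding it is what allows
      \<open>(g x x)\<^sup>2\<close> to be bounded by \<open>g x x * g y y\<close> below.\<close>
    have nonneg: "g x x \<ge> 0" if "x \<in> X" for x
    proof -
      have "g i i * g x x = g i x * g i x" using minors[of i i x x] i that sym[of x i] by simp
      also have "\<dots> \<ge> 0" by simp
      finally show ?thesis using i(2) by (simp add: zero_le_mult_iff)
    qed
    have pg: "p x * p y * g x y \<ge> 0" if "x \<in> X" "y \<in> X" for x y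
    proof -
      have "g i i * (p x * p y * g x y) = p x * p y * (g i i * g x y)" by simp
      also have "g i i * g x y = g i x * g i y" using minors[of i i x y] i that sym[of x i] by simp
      also have "p x * p y * (g i x * g i y) = (p x * g i x) * (p y * g i y)" by simp
      also have "\<dots> \<ge> 0" by (rule mult_nonneg_nonneg) (auto simp: p_def)
      finally show ?thesis using i(2) by (simp add: zero_le_mult_iff)
    qed
    have "p x * N x w * (p y * N y w) \<ge> 0"
      if x: "x \<in> X" and y: "y \<in> X" and w: "w \<in> W" and le: "g x x \<le> g y y" for x y w
    proof (cases "x = y")
      case True
      then show ?thesis by simp
    next
      case False
      \<comment> \<open>The row x has at most one nonzero entry more than the signed inner product, while a
          disagreement of the signed rows would make a difference of two.\<close>
      let ?h = "p x * p y * g x y"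
      have "(g x x)\<^sup>2 \<le> g x x * g y y"
        using le nonneg[OF x] by (simp add: power2_eq_square mult_left_mono)
      also have "\<dots> = g x y * g x y" using minors[of x x y y] x y sym[of y x] by simp
      also have "\<dots> = ?h\<^sup>2" using p[of x] p[of y] by (auto simp: power2_eq_square)
      finally have "g x x \<le> ?h" using pg[OF x y] by (rule power2_le_imp_le)
      then have h: "(\<Sum>u\<in>W. \<bar>N x u\<bar>) - 1 \<le> (\<Sum>u\<in>W. p x * N x u * (p y * N y u))"
        using False by (simp add: deg) (simp add: g_def sum_distrib_left algebra_simps)
      show ?thesis
      proof (rule ccontr)
        assume neg: "\<not> ?thesis"
        have pN: "\<bar>p x * N x u\<bar> = \<bar>N x u\<bar>" "\<bar>p y * N y u\<bar> \<le> 1" for u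
          using p[of x] p[of y] N[of y u] by auto
        have le: "p x * N x u * (p y * N y u) \<le> \<bar>N x u\<bar>" for u
        proof -
          have "p x * N x u * (p y * N y u) \<le> \<bar>p x * N x u\<bar> * \<bar>p y * N y u\<bar>"
            by (metis abs_ge_self abs_mult)
          also have "\<dots> \<le> \<bar>p x * N x u\<bar> * 1" by (intro mult_left_mono pN) auto
          finally show ?thesis using pN by simp
        qed
        have "2 \<le> \<bar>N x w\<bar> - p x * N x w * (p y * N y w)"
          using neg NN[of x w] by auto
        also have "\<dots> \<le> (\<Sum>u\<in>W. \<bar>N x u\<bar> - p x * N x u * (p y * N y u))"
          using w W le by (intro member_le_sum) auto
        also have "\<dots> \<le> 1" using h by (simp add: sum_subtractf)
        finally show False by simp
      qed
    qed
    then have "p x * N x w * (p y * N y w) \<ge> 0" if "x \<in> X" "y \<in> X" "w \<in> W" for x y w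
      using that by (metis linear mult.commute)
    then show ?thesis using p by blast
  qed
qed

text \<open>After multiplication of the rows by \<open>p\<close>, no column contains both signs, so
  \<open>q\<close> can record the sign of each column. A column without negative entries gets
  1.\<close>

lemma gram_rank_one_balanced:
  fixes N :: "'a \<Rightarrow> 'b \<Rightarrow> int" and W :: "'b set"
  defines "g \<equiv> \<lambda>x y. (\<Sum>w\<in>W. N x w * N y w) - (if x = y then 1 else 0)"
  assumes W: "finite W"
    and N: "\<And>x w. \<bar>N x w\<bar> \<le> 1"
    and minors: "\<And>i j k l. i \<in> X \<Longrightarrow> j \<in> X \<Longrightarrow> k \<in> X \<Longrightarrow> l \<in> X \<Longrightarrow> g i j * g k l = g i l * g k j"
  obtains p q where "\<And>x. p x \<in> {-1, 1}" "\<And>w. q w \<in> {-1, 1}"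
    "\<And>x w. x \<in> X \<Longrightarrow> w \<in> W \<Longrightarrow> p x * q w * N x w \<ge> 0"
proof -
  obtain p where p: "\<And>x. p x \<in> {-1, 1}"
    and pos: "\<And>x y w. x \<in> X \<Longrightarrow> y \<in> X \<Longrightarrow> w \<in> W \<Longrightarrow> p x * N x w * (p y * N y w) \<ge> 0"
  proof -
    have "\<exists>p. (\<forall>x. p x \<in> {-1, 1}) \<and>
             (\<forall>x\<in>X. \<forall>y\<in>X. \<forall>w\<in>W. p x * N x w * (p y * N y w) \<ge> 0)"
      using minors unfolding g_def by (intro gram_rank_one_signs[OF W N])
    then show thesis using that by blast
  qed
  define q :: "'b \<Rightarrow> int" where "q w = (if \<exists>x\<in>X. p x * N x w < 0 then -1 else 1)" for w
  have "p x * q w * N x w \<ge> 0" if x: "x \<in> X" and w: "w \<in> W" for x w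
  proof (cases "\<exists>y\<in>X. p y * N y w < 0")
    case True
    then obtain y where "y \<in> X" "p y * N y w < 0" by auto
    with pos[OF x this(1) w] have "p x * N x w \<le> 0"
      unfolding zero_le_mult_iff[of "p x * N x w"] by linarith
    then show ?thesis using True by (simp add: q_def)
  next
    case False
    then show ?thesis using x by (auto simp: q_def not_less)
  qed
  moreover have "q w \<in> {-1, 1}" for w by (simp add: q_def)
  ultimately show ?thesis using p that by blast
qed

section \<open>Linear algebra: rank of A A - I and sign conjugation\<close>

text \<open>A sum of two rank-one matrices has vanishing 3x3 determinants. The determinant, with
  rows \<open>i\<close>, \<open>k\<close>, \<open>m\<close> and columns \<open>j\<close>,
  \<open>l\<close>, \<open>n\<close>, is expanded along its first row and vanishes as a polynomial
  identity, so indices may repeat.\<close>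

lemma minor3_rank_two:
  fixes a b c d :: "'i \<Rightarrow> 'r::comm_ring_1"
  assumes M: "\<And>i j. i \<in> S \<Longrightarrow> j \<in> S \<Longrightarrow> M i j = a i * b j + c i * d j"
    and S: "i \<in> S" "j \<in> S" "k \<in> S" "l \<in> S" "m \<in> S" "n \<in> S"
  shows "M i j * (M k l * M m n - M k n * M m l) - M i l * (M k j * M m n - M k n * M m j)
         + M i n * (M k j * M m l - M k l * M m j) = 0"
  unfolding M[OF S(1,2)] M[OF S(1,4)] M[OF S(1,6)] M[OF S(3,2)] M[OF S(3,4)] M[OF S(3,6)]
    M[OF S(5,2)] M[OF S(5,4)] M[OF S(5,6)]
  by (simp add: algebra_simps)

text \<open>The row belongs to a block with eigenvalue \<open>a\<close>, which has size 1 and hence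
  no superdiagonal entry.\<close>

lemma jordan_matrix_diagonal_row:
  assumes "\<And>n. (n, a) \<in> set n_as \<Longrightarrow> n \<le> 1"
    and "i < sum_list (map fst n_as)" "j < sum_list (map fst n_as)" "i \<noteq> j"
    and "jordan_matrix n_as $$ (i, i) = a"
  shows "jordan_matrix n_as $$ (i, j) = 0"
  using assms
proof (induction n_as arbitrary: i j)
  case (Cons na n_as)
  obtain n b where na: "na = (n, b)" by force
  have J: "jordan_matrix n_as \<in> carrier_mat (sum_list (map fst n_as)) (sum_list (map fst n_as))"
    by simp
  have B: "jordan_block n b \<in> carrier_mat n n" by simp
  show ?case
  proof (cases "i < n")
    case True
    then have "b = a" using Cons.prems by (simp add: na jordan_matrix_Cons)
    then have "n \<le> 1" using Cons.prems(1)[of n] na by simp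
    with True have "i = 0" "n = 1" by auto
    then show ?thesis using Cons.prems by (auto simp: na jordan_matrix_Cons)
  next
    case False
    then show ?thesis using Cons.prems Cons.IH[of "i - n" "j - n"]
      by (auto simp: na jordan_matrix_Cons)
  qed
qed simp

text \<open>The squared norm of \<open>C *\<^sub>v v\<close> is the inner product of
  \<open>v\<close> with \<open>C *\<^sub>v (C *\<^sub>v v)\<close>, hence 0.\<close>

lemma hermitian_kernel_square:
  fixes C :: "complex mat"
  assumes C: "C \<in> carrier_mat n n"
    and sym: "\<And>i j. i < n \<Longrightarrow> j < n \<Longrightarrow> cnj (C $$ (i, j)) = C $$ (j, i)"
    and v: "v \<in> carrier_vec n" and z: "C *\<^sub>v (C *\<^sub>v v) = 0\<^sub>v n"
  shows "C *\<^sub>v v = 0\<^sub>v n"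
proof -
  define w where "w = C *\<^sub>v v"
  have w: "w \<in> carrier_vec n" using C v by (simp add: w_def)
  have wi: "w $ i = (\<Sum>j<n. C $$ (i, j) * v $ j)" if "i < n" for i
    using C v that by (simp add: w_def scalar_prod_def lessThan_atLeast0)
  have Cw: "(\<Sum>i<n. C $$ (j, i) * w $ i) = 0" if "j < n" for j
  proof -
    have "(C *\<^sub>v w) $ j = 0" using z that by (simp add: w_def)
    then show ?thesis using C w that by (simp add: scalar_prod_def lessThan_atLeast0)
  qed
  have "(\<Sum>i<n. cnj (w $ i) * w $ i) = (\<Sum>i<n. \<Sum>j<n. cnj (v $ j) * (C $$ (j, i) * w $ i))"
    by (intro sum.cong) (auto simp: wi sym sum_distrib_left sum_distrib_right mult_ac)
  also have "\<dots> = (\<Sum>j<n. cnj (v $ j) * (\<Sum>i<n. C $$ (j, i) * w $ i))"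
    by (subst sum.swap) (simp add: sum_distrib_left)
  also have "\<dots> = 0" by (simp add: Cw)
  finally have "complex_of_real (\<Sum>i<n. (cmod (w $ i))\<^sup>2) = 0"
    unfolding of_real_sum complex_norm_square by (simp add: mult.commute)
  then have "(\<Sum>i<n. (cmod (w $ i))\<^sup>2) = 0" by (simp only: of_real_eq_0_iff)
  then have "w $ i = 0" if "i < n" for i
    using that by (simp add: sum_nonneg_eq_0_iff)
  then have "w = 0\<^sub>v n" using w by (intro eq_vecI) auto
  then show ?thesis by (simp add: w_def)
qed

text \<open>A block of size at least 2 would make the kernel of the squared shifted matrix larger
  than the kernel of the shifted matrix itself. The eigenvalue has to be real for the shift to stay
  Hermitian.\<close>

lemma hermitian_jordan_block_size:
  fixes A :: "complex mat"
  assumes A: "A \<in> carrier_mat n n"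
    and sym: "\<And>i j. i < n \<Longrightarrow> j < n \<Longrightarrow> cnj (A $$ (i, j)) = A $$ (j, i)"
    and a: "cnj a = a"
    and jnf: "jordan_nf A n_as" and mem: "(m, a) \<in> set n_as"
  shows "m \<le> 1"
proof -
  let ?C = "char_matrix A a"
  have C: "?C \<in> carrier_mat n n" using A by simp
  have C_sym: "cnj (?C $$ (i, j)) = ?C $$ (j, i)" if "i < n" "j < n" for i j
    using that A sym[of i j] a by (auto simp: char_matrix_def)
  have pow: "?C ^\<^sub>m 1 = ?C" "?C ^\<^sub>m 2 = ?C * ?C"
    using C by (simp_all add: numeral_2_eq_2)
  have "mat_kernel (?C * ?C) = mat_kernel ?C"
    using C hermitian_kernel_square[OF C C_sym]
    by (auto simp: mat_kernel[OF C] mat_kernel[OF mult_carrier_mat[OF C C]] assoc_mult_mat_vec)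
  then have "dim_gen_eigenspace A a 1 = dim_gen_eigenspace A a 2"
    unfolding dim_gen_eigenspace_def pow kernel_dim_def using C by simp
  \<comment> \<open>A block of size \<open>k\<close> contributes \<open>min r k\<close> to the
    kernel of the \<open>r\<close>-th power. Equal sums force equality in each term, which fails for
    \<open>k \<ge> 2\<close>.\<close>
  then have eq: "(\<Sum>k\<leftarrow>map fst (filter (\<lambda>(k, e). e = a) n_as). min 1 k)
           = (\<Sum>k\<leftarrow>map fst (filter (\<lambda>(k, e). e = a) n_as). min 2 k)"
    by (simp only: dim_gen_eigenspace[OF jnf])
  have "k \<le> 1" if "k \<in> set ks" "(\<Sum>k\<leftarrow>ks. min 1 k) = (\<Sum>k\<leftarrow>ks. min 2 k)" for k and ks :: "nat list"
    using that
  proof (induction ks)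
    case (Cons l ks)
    have "(\<Sum>k\<leftarrow>ks. min 1 k) \<le> (\<Sum>k\<leftarrow>ks. min 2 k)"
      by (intro sum_list_mono) auto
    moreover have "min 1 l \<le> min 2 l" by auto
    ultimately have "min 1 l = min 2 l" "(\<Sum>k\<leftarrow>ks. min 1 k) = (\<Sum>k\<leftarrow>ks. min 2 k)"
      using Cons.prems(2) by simp_all
    then show ?case using Cons by auto
  qed simp
  from this[OF _ eq, of m] mem show ?thesis by force
qed

text \<open>In Jordan form, a row with diagonal entry 1 or -1 contributes nothing to
  \<open>J * J - 1\<^sub>m n\<close>, so at most two rows survive. Rank at most two is stated as an
  explicit sum of two products; its factors are complex because the Jordan form is taken over the
  complex numbers.\<close>

lemma symmetric_square_minus_one_rank_two:
  fixes A :: "real mat"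
  assumes A: "A \<in> carrier_mat n n"
    and sym: "\<And>i j. i < n \<Longrightarrow> j < n \<Longrightarrow> A $$ (i, j) = A $$ (j, i)"
    and ev: "size {#x \<in># eigenvalues_mset A. x \<noteq> 1 \<and> x \<noteq> -1#} \<le> 2"
  obtains a b c d :: "nat \<Rightarrow> complex" where
    "\<And>i j. i < n \<Longrightarrow> j < n \<Longrightarrow> complex_of_real ((A * A) $$ (i, j) - (if i = j then 1 else 0)) = a i * b j + c i * d j"
proof -
  let ?A = "map_mat complex_of_real A"
  have cA: "?A \<in> carrier_mat n n" using A by simp
  obtain as where "char_poly ?A = (\<Prod>a\<leftarrow>as. [:- a, 1:])"
    using char_poly_factorized[OF cA] by blast
  from jordan_nf_exists[OF cA this] obtain n_as where jnf: "jordan_nf ?A n_as" ..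
  define J where "J = jordan_matrix n_as"
  have simJ: "similar_mat ?A J" using jnf by (simp add: jordan_nf_def J_def)
  then obtain P Q where wit: "similar_mat_wit ?A J P Q" by (auto simp: similar_mat_def)
  have J: "J \<in> carrier_mat n n" and P: "P \<in> carrier_mat n n" and Q: "Q \<in> carrier_mat n n"
    and PQ: "P * Q = 1\<^sub>m n" and QP: "Q * P = 1\<^sub>m n" and AJ: "?A = P * J * Q"
    using similar_mat_witD2[OF cA wit] by auto
  have n: "n = sum_list (map fst n_as)" using J by (auto simp: J_def)
  have blocks: "k \<le> 1" if "(k, e) \<in> set n_as" "e = 1 \<or> e = -1" for k e
    using that by (intro hermitian_jordan_block_size[OF cA _ _ jnf]) (use A sym in auto)
  have J_row: "J $$ (i, j) = 0" if "i < n" "j < n" "i \<noteq> j" "J $$ (i, i) = 1 \<or> J $$ (i, i) = -1" for i j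
    using that blocks unfolding J_def n by (intro jordan_matrix_diagonal_row[OF _ _ _ _ refl]) auto
  define K where "K = {i. i < n \<and> J $$ (i, i) \<noteq> 1 \<and> J $$ (i, i) \<noteq> -1}"
  \<comment> \<open>The diagonal of the triangular matrix \<open>J\<close> lists the eigenvalues
    with multiplicity, so \<open>K\<close> has as many elements as there are exceptional
    eigenvalues.\<close>
  have spec: "eigenvalues_mset A = mset (diag_mat J)"
  proof -
    have "char_poly ?A = (\<Prod>a\<leftarrow>diag_mat J. [:- a, 1:])"
      unfolding char_poly_similar[OF simJ] using J
      by (intro char_poly_upper_triangular) (auto simp: J_def jordan_matrix_upper_triangular)
    moreover have "proots (\<Prod>a\<leftarrow>xs. [:- a, 1:]) = mset xs" for xs :: "complex list"
    proof (induction xs)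
      case (Cons x xs)
      have "(\<Prod>a\<leftarrow>xs. [:- a, 1:]) \<noteq> 0" by (auto simp: prod_list_zero_iff)
      then have "proots ([:- x, 1:] * (\<Prod>a\<leftarrow>xs. [:- a, 1:])) = {#x#} + mset xs"
        by (subst proots_mult) (simp_all add: Cons.IH)
      then show ?case by simp
    qed simp
    ultimately show ?thesis by (simp only: eigenvalues_mset_def)
  qed
  have "card K \<le> 2"
  proof -
    let ?P = "\<lambda>x :: complex. x \<noteq> 1 \<and> x \<noteq> -1"
    have "{#x \<in># eigenvalues_mset A. ?P x#} = mset (filter ?P (diag_mat J))"
      by (simp only: spec mset_filter)
    then have "length (filter ?P (diag_mat J)) \<le> 2" using ev by (simp only: size_mset)
    also have "length (filter ?P (diag_mat J)) = length (filter (\<lambda>i. ?P (J $$ (i, i))) [0..<n])"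
      using J by (simp add: diag_mat_def filter_map o_def)
    also have "\<dots> = card K"
      by (subst distinct_length_filter) (auto simp: K_def intro!: arg_cong[of _ _ card])
    finally show ?thesis .
  qed
  have JJ: "(J * J) $$ (i, j) = (if i = j then 1 else 0)" if "i < n" "j < n" "i \<notin> K" for i j
  proof -
    have Ji: "J $$ (i, i) = 1 \<or> J $$ (i, i) = -1" using that by (auto simp: K_def)
    have "(J * J) $$ (i, j) = (\<Sum>k<n. J $$ (i, k) * J $$ (k, j))"
      using J that by (simp add: scalar_prod_def lessThan_atLeast0)
    also have "\<dots> = (\<Sum>k<n. if k = i then J $$ (i, i) * J $$ (i, j) else 0)"
      using J_row[OF that(1) _ _ Ji] by (intro sum.cong) auto
    also have "\<dots> = J $$ (i, i) * J $$ (i, j)" using that by simp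
    also have "\<dots> = (if i = j then 1 else 0)" using Ji J_row[OF that(1,2) _ Ji] by auto
    finally show ?thesis .
  qed
  \<comment> \<open>Conjugating back gives \<open>?A * ?A - 1\<^sub>m n = P * R\<close>. The rows of
    \<open>R\<close> outside \<open>K\<close> vanish, so the columns of \<open>P\<close> and the
    rows of \<open>R\<close> with index in \<open>K\<close> are the desired factors.\<close>
  define R where "R = (J * J - 1\<^sub>m n) * Q"
  have R: "R \<in> carrier_mat n n" unfolding R_def using J Q by (intro mult_carrier_mat[of _ n n] minus_carrier_mat) auto
  have R_row: "R $$ (i, j) = 0" if "i < n" "j < n" "i \<notin> K" for i j
    using that J Q JJ[OF that(1) _ that(3)] by (simp add: R_def scalar_prod_def)
  have PR: "?A * ?A - 1\<^sub>m n = P * R"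
  proof -
    have "?A * ?A = P * J * (Q * P) * J * Q"
      using P Q J by (simp add: AJ assoc_mult_mat[of _ n n _ n _ n])
    also have "\<dots> = P * (J * J) * Q"
      using P Q J by (simp add: QP assoc_mult_mat[of _ n n _ n _ n])
    finally have "?A * ?A - 1\<^sub>m n = P * (J * J) * Q - P * 1\<^sub>m n * Q"
      using P Q by (simp add: PQ)
    also have "\<dots> = P * R"
      using P Q J unfolding R_def
      by (simp add: minus_mult_distrib_mat[of _ n n] mult_minus_distrib_mat[of P n n "J * (J * Q)" n Q]
          assoc_mult_mat[of _ n n _ n _ n])
    finally show ?thesis .
  qed
  have entry: "complex_of_real ((A * A) $$ (i, j) - (if i = j then 1 else 0)) = (\<Sum>k\<in>K. P $$ (i, k) * R $$ (k, j))"
    if "i < n" "j < n" for i j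
  proof -
    have "complex_of_real ((A * A) $$ (i, j) - (if i = j then 1 else 0)) = (?A * ?A - 1\<^sub>m n) $$ (i, j)"
      using that A by (simp add: scalar_prod_def)
    also have "\<dots> = (\<Sum>k<n. P $$ (i, k) * R $$ (k, j))"
      unfolding PR using that P R by (simp add: scalar_prod_def lessThan_atLeast0)
    also have "\<dots> = (\<Sum>k\<in>K. P $$ (i, k) * R $$ (k, j))"
      using R_row that by (intro sum.mono_neutral_right) (auto simp: K_def)
    finally show ?thesis .
  qed
  have "finite K" by (simp add: K_def)
  \<comment> \<open>If there are fewer than two exceptional indices, zero functions fill the missing
    products.\<close>
  consider "K = {}" | k where "K = {k}" | k l where "K = {k, l}" "k \<noteq> l"
  proof -
    have "card K = 0 \<or> card K = 1 \<or> card K = 2" using \<open>card K \<le> 2\<close> by linarith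
    then show thesis using that \<open>finite K\<close> by (auto simp: card_1_singleton_iff card_2_iff)
  qed
  then show thesis
  proof cases
    case 1
    then show ?thesis using entry by (intro that[of "\<lambda>_. 0" "\<lambda>_. 0" "\<lambda>_. 0" "\<lambda>_. 0"]) simp
  next
    case (2 k)
    then show ?thesis using entry
      by (intro that[of "\<lambda>i. P $$ (i, k)" "\<lambda>j. R $$ (k, j)" "\<lambda>_. 0" "\<lambda>_. 0"]) simp
  next
    case (3 k l)
    then show ?thesis using entry
      by (intro that[of "\<lambda>i. P $$ (i, k)" "\<lambda>j. R $$ (k, j)" "\<lambda>i. P $$ (i, l)" "\<lambda>j. R $$ (l, j)"]) simp
  qed
qed

text \<open>The diagonal matrix of \<open>t\<close> is its own inverse, so \<open>B\<close> is
  similar to \<open>A\<close>.\<close>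

lemma eigenvalues_mset_sign_conjugate:
  assumes A: "A \<in> carrier_mat n n" and B: "B \<in> carrier_mat n n"
    and t: "\<And>i. i < n \<Longrightarrow> t i * t i = 1"
    and AB: "\<And>i j. i < n \<Longrightarrow> j < n \<Longrightarrow> B $$ (i, j) = t i * A $$ (i, j) * t j"
  shows "eigenvalues_mset B = eigenvalues_mset A"
proof -
  define D where "D = mat n n (\<lambda>(i, j). if i = j then complex_of_real (t i) else 0)"
  let ?A = "map_mat complex_of_real A" and ?B = "map_mat complex_of_real B"
  have D: "D \<in> carrier_mat n n" by (simp add: D_def)
  have cA: "?A \<in> carrier_mat n n" and cB: "?B \<in> carrier_mat n n" using A B by auto
  have left: "(D * M) $$ (i, j) = complex_of_real (t i) * M $$ (i, j)"
    if "M \<in> carrier_mat n n" "i < n" "j < n" for M i j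
  proof -
    have "(D * M) $$ (i, j) = (\<Sum>k<n. (if i = k then complex_of_real (t i) else 0) * M $$ (k, j))"
      using that by (simp add: D_def scalar_prod_def lessThan_atLeast0)
    also have "\<dots> = (\<Sum>k<n. if i = k then complex_of_real (t i) * M $$ (i, j) else 0)"
      by (intro sum.cong) auto
    finally show ?thesis using that by simp
  qed
  have right: "(M * D) $$ (i, j) = M $$ (i, j) * complex_of_real (t j)"
    if "M \<in> carrier_mat n n" "i < n" "j < n" for M i j
  proof -
    have "(M * D) $$ (i, j) = (\<Sum>k<n. M $$ (i, k) * (if k = j then complex_of_real (t k) else 0))"
      using that by (simp add: D_def scalar_prod_def lessThan_atLeast0)
    also have "\<dots> = (\<Sum>k<n. if k = j then M $$ (i, j) * complex_of_real (t j) else 0)"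
      by (intro sum.cong) auto
    finally show ?thesis using that by simp
  qed
  have DD: "D * D = 1\<^sub>m n"
  proof (rule eq_matI)
    fix i j assume "i < dim_row (1\<^sub>m n :: complex mat)" "j < dim_col (1\<^sub>m n :: complex mat)"
    then have ij: "i < n" "j < n" by auto
    have "complex_of_real (t i) * complex_of_real (t i) = 1"
      using t[OF ij(1)] by (metis of_real_1 of_real_mult)
    then show "(D * D) $$ (i, j) = 1\<^sub>m n $$ (i, j)"
      using left[OF D ij] ij by (auto simp: D_def)
  qed (use D in auto)
  have "?B = D * ?A * D"
  proof (rule eq_matI)
    fix i j assume "i < dim_row (D * ?A * D)" "j < dim_col (D * ?A * D)"
    then have ij: "i < n" "j < n" using D by auto
    show "?B $$ (i, j) = (D * ?A * D) $$ (i, j)"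
      using right[OF mult_carrier_mat[OF D cA] ij] left[OF cA ij] ij A B AB[OF ij] by simp
  qed (use D B in auto)
  then have "similar_mat ?B ?A"
    unfolding similar_mat_def similar_mat_wit_def Let_def
    using DD D cA cB B by (intro exI[of _ D]) (simp del: assoc_mult_mat)
  then show ?thesis by (simp add: eigenvalues_mset_def char_poly_similar)
qed

section \<open>Signed bipartite graphs: balance and switching\<close>

text \<open>Indexing by vertices keeps the arbitrary \<open>vertex_order\<close> out of the
  combinatorial argument.\<close>

definition signed_adj :: "'a pair_pre_digraph \<Rightarrow> ('a set \<Rightarrow> int) \<Rightarrow> 'a \<Rightarrow> 'a \<Rightarrow> int" where
  "signed_adj G \<sigma> u v = (if (u, v) \<in> parcs G then \<sigma> {u, v} else 0)"

lemma adjacency_matrix_index: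
  assumes "i < length (vertex_order G)" "j < length (vertex_order G)"
  shows "adjacency_matrix G \<sigma> $$ (i, j)
         = real_of_int (signed_adj G \<sigma> (vertex_order G ! i) (vertex_order G ! j))"
  using assms by (simp add: adjacency_matrix_def Let_def signed_adj_def)

lemma adjacency_matrix_carrier:
  "adjacency_matrix G \<sigma> \<in> carrier_mat (length (vertex_order G)) (length (vertex_order G))"
  by (simp add: adjacency_matrix_def Let_def)

lemma signed_adj_sym:
  assumes "pair_graph G"
  shows "signed_adj G \<sigma> u v = signed_adj G \<sigma> v u"
proof -
  interpret pair_graph G by fact
  show ?thesis using arcs_symmetric by (auto simp: signed_adj_def insert_commute)
qed

text \<open>By symmetry of the adjacency matrix, \<open>M\<close> is its square minus the identity,
  written as a Gram matrix of rows indexed by vertices. The rank bound over the complex numbers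
  yields the integer identity because the embedding of the integers is injective.\<close>

lemma adjacency_square_minor3:
  fixes G :: "'a pair_pre_digraph" and \<sigma> :: "'a set \<Rightarrow> int"
  defines "M \<equiv> \<lambda>u v. (\<Sum>w\<in>pverts G. signed_adj G \<sigma> u w * signed_adj G \<sigma> v w) - (if u = v then 1 else 0)"
  assumes G: "pair_graph G"
    and ev: "size {#x \<in># eigenvalues_mset (adjacency_matrix G \<sigma>). x \<noteq> 1 \<and> x \<noteq> -1#} \<le> 2"
    and V: "i \<in> pverts G" "j \<in> pverts G" "k \<in> pverts G" "l \<in> pverts G" "m \<in> pverts G" "n \<in> pverts G"
  shows "M i j * (M k l * M m n - M k n * M m l) - M i l * (M k j * M m n - M k n * M m j)
         + M i n * (M k j * M m l - M k l * M m j) = 0"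
proof -
  let ?vs = "vertex_order G" and ?A = "adjacency_matrix G \<sigma>"
  let ?n = "length ?vs"
  have bij: "bij_betw ((!) ?vs) {..<?n} (pverts G)"
    using vertex_order[OF G] by (intro bij_betw_nth) auto
  have sym: "?A $$ (i, j) = ?A $$ (j, i)" if "i < ?n" "j < ?n" for i j
    using that signed_adj_sym[OF G] by (simp add: adjacency_matrix_index)
  obtain a b c d :: "nat \<Rightarrow> complex" where rank: "\<And>i j. i < ?n \<Longrightarrow> j < ?n \<Longrightarrow>
      complex_of_real ((?A * ?A) $$ (i, j) - (if i = j then 1 else 0)) = a i * b j + c i * d j"
    using symmetric_square_minus_one_rank_two[OF adjacency_matrix_carrier sym ev] by blast
  \<comment> \<open>\<open>f\<close> sends a vertex to its position in the list and so carries the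
    factors over to vertices.\<close>
  define f where "f = the_inv_into {..<?n} ((!) ?vs)"
  have f: "f u < ?n" "?vs ! f u = u" if "u \<in> pverts G" for u
    using that bij the_inv_into_into[of "(!) ?vs" "{..<?n}" u "{..<?n}"]
      f_the_inv_into_f[of "(!) ?vs" "{..<?n}" u]
    by (auto simp: f_def bij_betw_def)
  have M: "complex_of_int (M u v) = a (f u) * b (f v) + c (f u) * d (f v)"
    if u: "u \<in> pverts G" and v: "v \<in> pverts G" for u v
  proof -
    have "(?A * ?A) $$ (f u, f v) = (\<Sum>i<?n. ?A $$ (f u, i) * ?A $$ (i, f v))"
      using adjacency_matrix_carrier[of G \<sigma>] f[OF u] f[OF v] by (simp add: scalar_prod_def lessThan_atLeast0)
    also have "\<dots> = (\<Sum>i<?n. real_of_int (signed_adj G \<sigma> u (?vs ! i) * signed_adj G \<sigma> v (?vs ! i)))"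
      using f[OF u] f[OF v] signed_adj_sym[OF G, of \<sigma> v]
      by (intro sum.cong) (auto simp: adjacency_matrix_index)
    also have "\<dots> = (\<Sum>w\<in>pverts G. real_of_int (signed_adj G \<sigma> u w * signed_adj G \<sigma> v w))"
      by (rule sum.reindex_bij_betw[OF bij])
    finally have "(?A * ?A) $$ (f u, f v) - (if f u = f v then 1 else 0) = real_of_int (M u v)"
      using f[OF u] f[OF v] by (auto simp: M_def)
    then show ?thesis using rank[OF f(1)[OF u] f(1)[OF v]] by simp
  qed
  have "complex_of_int (M i j * (M k l * M m n - M k n * M m l) - M i l * (M k j * M m n - M k n * M m j)
         + M i n * (M k j * M m l - M k l * M m j)) = 0"
    using minor3_rank_two[where M = "\<lambda>u v. complex_of_int (M u v)", OF M V] by simp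
  then show ?thesis by (simp only: of_int_eq_0_iff)
qed

text \<open>\<open>M\<close> is block diagonal for the bipartition. Either its block on
  \<open>Y\<close> is zero, or a nonzero entry there turns the vanishing 3x3 minors into vanishing
  2x2 minors on \<open>X\<close>. So one part can supply the rows for the rank-one lemma.\<close>

lemma bipartite_two_exceptional_balanced:
  assumes sg: "signed_graph G \<sigma>" and bip: "bipartite_graph G"
    and ev: "size {#x \<in># eigenvalues_mset (adjacency_matrix G \<sigma>). x \<noteq> 1 \<and> x \<noteq> -1#} \<le> 2"
  obtains t where "\<And>v. t v \<in> {-1, 1}" "\<And>u v. (u, v) \<in> parcs G \<Longrightarrow> \<sigma> {u, v} = t u * t v"
proof -
  have G: "pair_graph G" and \<sigma>: "\<And>u v. (u, v) \<in> parcs G \<Longrightarrow> \<sigma> {u, v} \<in> {-1, 1}"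
    using sg by (auto simp: signed_graph_def)
  interpret pair_graph G by fact
  let ?s = "signed_adj G \<sigma>"
  obtain X Y where XY: "pverts G = X \<union> Y" "X \<inter> Y = {}" "parcs G \<subseteq> X \<times> Y \<union> Y \<times> X"
    using bip by (auto simp: bipartite_graph_def)
  have fin: "finite X" "finite Y" using XY(1) pair_finite_verts by auto
  have s: "\<bar>?s u v\<bar> \<le> 1" for u v using \<sigma>[of u v] by (auto simp: signed_adj_def)
  define M where "M u v = (\<Sum>w\<in>pverts G. ?s u w * ?s v w) - (if u = v then 1 else 0)" for u v
  have s0: "?s u v = 0" if "u \<in> X \<and> v \<in> X \<or> u \<in> Y \<and> v \<in> Y" for u v
    using that XY by (auto simp: signed_adj_def)
  have MX: "M u v = (\<Sum>w\<in>Y. ?s u w * ?s v w) - (if u = v then 1 else 0)" if "u \<in> X" for u v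
    unfolding M_def XY(1) using that XY(2) fin s0
    by (auto simp: sum.union_disjoint)
  have MY: "M u v = (\<Sum>w\<in>X. ?s u w * ?s v w) - (if u = v then 1 else 0)" if "u \<in> Y" for u v
    unfolding M_def XY(1) using that XY(2) fin s0
    by (auto simp: sum.union_disjoint)
  have M0: "M u v = 0" "M v u = 0" if "u \<in> X" "v \<in> Y" for u v
    using that XY(2) s0 by (auto simp: MX MY)
  obtain p q where p: "\<And>x. p x \<in> {-1, 1 :: int}" and q: "\<And>y. q y \<in> {-1, 1 :: int}"
    and pq: "\<And>x y. x \<in> X \<Longrightarrow> y \<in> Y \<Longrightarrow> p x * q y * ?s x y \<ge> 0"
  proof (cases "\<forall>u\<in>Y. \<forall>v\<in>Y. M u v = 0")
    case True
    show ?thesis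
    proof (rule gram_rank_one_balanced[of X ?s Y, OF fin(1) s], goal_cases)
      case (1 i j k l)
      have "M i j * M k l = M i l * M k j" using True 1 by simp
      then show ?case using 1 by (simp only: MY)
    next
      \<comment> \<open>Here the rows are indexed by \<open>Y\<close>, so the row signs play the
        role of \<open>q\<close> and the column signs that of \<open>p\<close>.\<close>
      case (2 q p)
      show ?thesis
        by (rule that[of p q], rule 2, rule 2, subst signed_adj_sym[OF G], subst mult.commute[of "p _"], rule 2)
    qed
  next
    case False
    then obtain y z where yz: "y \<in> Y" "z \<in> Y" "M y z \<noteq> 0" by auto
    have minors: "M i j * M k l = M i l * M k j" if "i \<in> X" "j \<in> X" "k \<in> X" "l \<in> X" for i j k l
    proof -
      \<comment> \<open>This is the 3x3 minor with rows \<open>i\<close>, \<open>k\<close>,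
        \<open>y\<close> and columns \<open>j\<close>, \<open>l\<close>, \<open>z\<close>: the mixed
        entries vanish, so it factors.\<close>
      have "(M i j * M k l - M i l * M k j) * M y z = 0"
        using adjacency_square_minor3[OF G ev, of i j k l y z, folded M_def] that yz M0 XY(1)
        by (simp add: algebra_simps)
      then show ?thesis using yz by simp
    qed
    show ?thesis
    proof (rule gram_rank_one_balanced[of Y ?s X, OF fin(2) s], goal_cases)
      case (1 i j k l)
      then show ?case using minors[OF 1] by (simp only: MX)
    qed (rule that)
  qed
  define t where "t v = (if v \<in> X then p v else q v)" for v
  have t: "t v \<in> {-1, 1}" for v using p[of v] q[of v] by (auto simp: t_def)
  \<comment> \<open>On an edge the nonnegative number \<open>p u * q v * ?s u v\<close> is 1 or -1,
    hence 1.\<close>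
  have XY_edge: "\<sigma> {u, v} = t u * t v" if "(u, v) \<in> parcs G" "u \<in> X" "v \<in> Y" for u v
    using pq[OF that(2,3)] p[of u] q[of v] \<sigma>[OF that(1)] that XY(2)
    by (auto simp: t_def signed_adj_def)
  have "\<sigma> {u, v} = t u * t v" if uv: "(u, v) \<in> parcs G" for u v
  proof (cases "u \<in> X")
    case True
    then show ?thesis using XY_edge[OF uv] uv XY by auto
  next
    case False
    then show ?thesis using XY_edge[of v u] arcs_symmetric[OF uv] uv XY
      by (auto simp: insert_commute mult.commute)
  qed
  with t show ?thesis using that by blast
qed

theorem theorem4p1:
  fixes G :: "'a pair_pre_digraph" and \<sigma> :: "'a set \<Rightarrow> int"
  assumes "signed_graph G \<sigma>"
    and "connected_graph G"
    and "bipartite_graph G"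
    and "size {#x \<in># eigenvalues_mset (adjacency_matrix G \<sigma>). x \<noteq> 1 \<and> x \<noteq> -1#} \<le> 2"
  shows "\<exists>H :: 'a pair_pre_digraph.
           pair_graph H \<and> connected_graph H \<and> bipartite_graph H \<and>
           size {#x \<in># eigenvalues_mset (adjacency_matrix H all_positive). x \<noteq> 1 \<and> x \<noteq> -1#} \<le> 2 \<and>
           switching_isomorphic G \<sigma> H all_positive"
proof -
  have G: "pair_graph G" using assms(1) by (simp add: signed_graph_def)
  interpret pair_graph G by fact
  obtain t where t: "\<And>v. t v \<in> {-1, 1}" and \<sigma>: "\<And>u v. (u, v) \<in> parcs G \<Longrightarrow> \<sigma> {u, v} = t u * t v"
    using bipartite_two_exceptional_balanced[OF assms(1,3,4)] by blast
  have tt: "t v * t v = 1" for v using t[of v] by auto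
  have adj: "signed_adj G all_positive u v = t u * signed_adj G \<sigma> u v * t v" for u v
    using t[of u] t[of v] \<sigma>[of u v] by (auto simp: signed_adj_def all_positive_def)
  \<comment> \<open>The witness \<open>H\<close> is \<open>G\<close> itself, so connectedness and
    bipartiteness carry over and only the spectrum has to be compared.\<close>
  have "eigenvalues_mset (adjacency_matrix G all_positive) = eigenvalues_mset (adjacency_matrix G \<sigma>)"
    by (rule eigenvalues_mset_sign_conjugate[OF adjacency_matrix_carrier adjacency_matrix_carrier,
          of _ "\<lambda>i. real_of_int (t (vertex_order G ! i))"])
       (simp_all add: adjacency_matrix_index adj tt flip: of_int_mult)
  moreover have "switching_isomorphic G \<sigma> G all_positive"
  proof -
    \<comment> \<open>An edge is flipped exactly when \<open>t\<close> differs at its ends, that is,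
      when its sign is -1.\<close>
    let ?X = "{v \<in> pverts G. t v = -1}"
    have "switch ?X \<sigma> {u, v} = 1" if uv: "(u, v) \<in> parcs G" for u v
      using t[of u] t[of v] \<sigma>[OF uv] uv in_arcsD1[OF uv] in_arcsD2[OF uv] by (auto simp: switch_def)
    then have "signed_graph_iso G (switch ?X \<sigma>) G all_positive"
      unfolding signed_graph_iso_def by (intro exI[of _ id]) (auto simp: all_positive_def)
    then show ?thesis unfolding switching_isomorphic_def by (intro exI[of _ ?X]) simp
  qed
  ultimately show ?thesis using assms G by auto
qed

end
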